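(* Let $\mathcal{Q}$ be a thick finite generalized quadrangle of order $(s,t)$, where $s > t$ and $s+1$ is prime. If \[ s \left\lceil \left\lceil \frac{t^2}{s+1}\right\rceil\left(\frac{s+1}{t} \right) \right\rceil > t(s+t),\] then $\mathcal{Q}$ does not have an automorphism of order $s+1$, and the automorphism group of $\mathcal{Q}$ is not transitive on the points of $\mathcal{Q}$.
   Context: A finite generalized quadrangle of order $(s,t)$, with $s,t$ positive integers, is an incidence structure consisting of a finite set $\mathcal{P}$ of points, a finite set $\mathcal{L}$ of lines disjoint from $\mathcal{P}$, and a symmetric point-line incidence relation such that: each point is incident with exactly $t+1$ lines and each line is incident with exactly $s+1$ points; two distinct points are mutually incident with at most one line, and two distinct lines are mutually incident with at most one point; and for each point $P$ and each line $\ell$ not incident with $P$ there is a unique pair $(P',\ell') \in \mathcal{P}\times\mathcal{L}$ such that $P$ is incident with $\ell'$, $\ell'$ is incident with $P'$, and $P'$ is incident with $\ell$. It is thick if $s>1$ and $t>1$. An automorphism of $\mathcal{Q}$ is a permutation of the point set that preserves collinearity (two points are collinear if some line is incident with both); it induces a permutation of the lines preserving incidence. The order of an automorphism is its order as an element of the automorphism group. *)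

theory Defs
  imports Complex_Main "HOL-Computational_Algebra.Primes"
    "HOL-Algebra.Group_Action" "HOL-Algebra.Multiplicative_Group"
begin

text \<open>Points and lines live in two different types, so the two sets are disjoint by typing;
  the symmetric incidence relation is represented by its point-to-line half. The point set is
  required to be nonempty, as in the standard definition: otherwise the structure with no
  points and no lines would qualify for all \<open>s\<close> and \<open>t\<close>, and every group acts transitively on
  the empty set. Together with \<open>point_degree\<close> this gives the existence of lines.\<close>

locale finite_generalized_quadrangle =
  fixes points :: "'p set"
    and lines :: "'l set"
    and incident :: "'p \<Rightarrow> 'l \<Rightarrow> bool"
    and s t :: nat
  assumes finite_points: "finite points"
    and finite_lines: "finite lines"
    and points_nonempty: "points \<noteq> {}"
    and s_pos: "0 < s"
    and t_pos: "0 < t"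
    and point_degree: "p \<in> points \<Longrightarrow> card {l \<in> lines. incident p l} = t + 1"
    and line_size: "l \<in> lines \<Longrightarrow> card {p \<in> points. incident p l} = s + 1"
    and at_most_one_line: "\<lbrakk>p \<in> points; q \<in> points; p \<noteq> q\<rbrakk>
      \<Longrightarrow> card {l \<in> lines. incident p l \<and> incident q l} \<le> 1"
    and at_most_one_point: "\<lbrakk>l \<in> lines; m \<in> lines; l \<noteq> m\<rbrakk>
      \<Longrightarrow> card {p \<in> points. incident p l \<and> incident p m} \<le> 1"
    and unique_projection: "\<lbrakk>p \<in> points; l \<in> lines; \<not> incident p l\<rbrakk>
      \<Longrightarrow> \<exists>!z. z \<in> points \<times> lines
            \<and> incident p (snd z) \<and> incident (fst z) (snd z) \<and> incident (fst z) l"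

locale thick_finite_generalized_quadrangle = finite_generalized_quadrangle +
  assumes s_gt_1: "1 < s"
    and t_gt_1: "1 < t"

definition collinear :: "'l set \<Rightarrow> ('p \<Rightarrow> 'l \<Rightarrow> bool) \<Rightarrow> 'p \<Rightarrow> 'p \<Rightarrow> bool" where
  "collinear lines incident p q \<longleftrightarrow> (\<exists>l \<in> lines. incident p l \<and> incident q l)"

text \<open>Elements of \<open>Bij points\<close> are permutations of the point set, made extensional (equal to
  \<open>undefined\<close> outside it) so that each permutation is represented exactly once.\<close>

definition automorphisms :: "'p set \<Rightarrow> 'l set \<Rightarrow> ('p \<Rightarrow> 'l \<Rightarrow> bool) \<Rightarrow> ('p \<Rightarrow> 'p) set" where
  "automorphisms points lines incident =
    {f \<in> Bij points. \<forall>p \<in> points. \<forall>q \<in> points.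
       collinear lines incident (f p) (f q) \<longleftrightarrow> collinear lines incident p q}"

definition automorphism_group ::
    "'p set \<Rightarrow> 'l set \<Rightarrow> ('p \<Rightarrow> 'l \<Rightarrow> bool) \<Rightarrow> ('p \<Rightarrow> 'p) monoid" where
  "automorphism_group points lines incident =
    BijGroup points \<lparr>carrier := automorphisms points lines incident\<rparr>"

lemma subgroup_automorphisms:
  "subgroup (automorphisms points lines incident) (BijGroup points)"
proof (rule subgroup.intro)
  show "automorphisms points lines incident \<subseteq> carrier (BijGroup points)"
    by (auto simp: automorphisms_def BijGroup_def)
next
  fix f g
  assume "f \<in> automorphisms points lines incident" "g \<in> automorphisms points lines incident"
  then show "f \<otimes>\<^bsub>BijGroup points\<^esub> g \<in> automorphisms points lines incident"
    using Bij_imp_funcset[of g points]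
    by (auto simp: automorphisms_def BijGroup_def compose_Bij compose_eq Pi_iff)
next
  show "\<one>\<^bsub>BijGroup points\<^esub> \<in> automorphisms points lines incident"
    by (auto simp: automorphisms_def BijGroup_def id_Bij)
next
  fix f
  assume f: "f \<in> automorphisms points lines incident"
  then have B: "f \<in> Bij points"
    by (simp add: automorphisms_def)
  have inv: "inv_into points f p \<in> points" "f (inv_into points f p) = p" if "p \<in> points" for p
    using B that by (auto simp: Bij_inv_into_mem Bij_def bij_betw_inv_into_right)
  have "collinear lines incident (inv_into points f p) (inv_into points f q)
      \<longleftrightarrow> collinear lines incident p q" if "p \<in> points" "q \<in> points" for p q
    using f inv[OF that(1)] inv[OF that(2)] unfolding automorphisms_def by force
  then show "inv\<^bsub>BijGroup points\<^esub> f \<in> automorphisms points lines incident"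
    using B by (auto simp: inv_BijGroup automorphisms_def restrict_inv_into_Bij)
qed

lemma group_automorphism_group: "group (automorphism_group points lines incident)"
  unfolding automorphism_group_def
  by (rule subgroup.subgroup_is_group[OF subgroup_automorphisms group_BijGroup])

lemma group_action_automorphism_group:
  "group_action (automorphism_group points lines incident) points (\<lambda>f. f)"
  using subgroup_automorphisms[of points lines incident]
    group_automorphism_group[of points lines incident] group_BijGroup[of points]
  by (auto simp: group_action_def group_hom_def group_hom_axioms_def hom_def
      automorphism_group_def dest: subgroup.mem_carrier)

text \<open>Hence denying \<open>transitive_action\<close> for this action denies exactly transitivity.\<close>

lemma transitive_action_automorphism_group_iff:
  "transitive_action (automorphism_group points lines incident) points (\<lambda>f. f) \<longleftrightarrow>
    (\<forall>x \<in> points. \<forall>y \<in> points. \<exists>f \<in> automorphisms points lines incident. f x = y)"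
  using group_action_automorphism_group[of points lines incident]
  by (auto simp: transitive_action_def transitive_action_axioms_def automorphism_group_def)

end

theory Submission
  imports Defs "HOL-Algebra.Sylow"
begin

text \<open>
  Let \<open>p = s + 1\<close> be prime and let \<open>f\<close> be an automorphism of order \<open>p\<close>. Its orbits on points and
  on lines have length \<open>1\<close> or \<open>p\<close>. A point has \<open>t + 1 < p\<close> lines through it, so all lines through a
  fixed point are fixed; a fixed line with a fixed point has at most \<open>p - 1\<close> further points that could
  move, so it is fixed pointwise. Since any two points are joined by a path of at most two lines,
  one fixed point would make \<open>f\<close> the identity. Hence \<open>f\<close> has no fixed point, and therefore two
  fixed lines never meet.

  Counting lines modulo \<open>p\<close> shows that \<open>p\<close> divides \<open>g + t\<^sup>2 - 1\<close>, where \<open>g\<close> is the number of fixed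
  lines (\<open>dvd_card_fixed_lines\<close>); in particular \<open>g > 0\<close>. So \<open>(g - 1) + t\<^sup>2\<close> is a positive multiple
  of \<open>p\<close>, hence at least \<open>\<lceil>t\<^sup>2 / p\<rceil> p\<close>. Choose a fixed line \<open>l\<close> and a point \<open>x\<close> on it. Each of
  the \<open>g - 1\<close> other fixed lines is met by exactly one of the \<open>t\<close> lines through \<open>x\<close> other than
  \<open>l\<close>, so one of these, say \<open>m\<close>, meets \<open>n \<ge> (g - 1) / t\<close> of them. The \<open>p\<close> images of \<open>m\<close>
  under powers of \<open>f\<close> are pairwise disjoint, and each of them meets \<open>l\<close> and the \<open>n\<close> other fixed lines
  met by \<open>m\<close>.

  The contradiction comes from a bound on such configurations (\<open>complete_bipartite_bound\<close>): if two
  sets of pairwise disjoint lines have the property that each line of one meets each line of the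
  other, then the product of their sizes, each diminished by one, is at most \<open>t\<^sup>2\<close>. This
  is Cauchy--Schwarz for a positive semidefinite form on the lines, a multiple of the projection
  onto an eigenspace of the concurrency matrix. Here it says \<open>s n \<le> t\<^sup>2\<close> (\<open>fixed_lines_bound\<close>), and
  combined with the lower bound for \<open>n + t\<close> it gives the opposite of the assumed inequality
  (\<open>parameter_inequality\<close>).

  A group that is transitive on the \<open>(s + 1)(st + 1)\<close> points has order divisible by \<open>p\<close>, and
  Cauchy's theorem then produces an element of order \<open>p\<close>; so the second claim follows from the first.
\<close>

section \<open>Permutations of prime order\<close>

text \<open>If the \<open>i\<close>-th and \<open>j\<close>-th iterates agree, then \<open>p\<close> and \<open>d = j - i\<close> are coprime periods of
  \<open>x\<close>, and by Bezout so is \<open>1\<close>.\<close>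

lemma prime_period_funpow_inj:
  assumes p: "prime p" and per: "(f ^^ p) x = x" and moved: "f x \<noteq> x"
    and i: "i < p" and j: "j < p" and eq: "(f ^^ i) x = (f ^^ j) x"
  shows "i = j"
proof -
  have no_shorter: False if ij: "i < j" "j < p" and eq: "(f ^^ i) x = (f ^^ j) x" for i j
  proof -
    define d where "d = j - i"
    have "(f ^^ d) x = (f ^^ (p - i + j)) x"
      using funpow_mod_eq[OF per, of "p - i + j"] funpow_mod_eq[OF per, of d] ij
      by (metis Nat.add_diff_assoc2 Nat.diff_add_assoc add.commute d_def less_imp_le mod_add_self2 order.strict_trans)
    also have "\<dots> = (f ^^ (p - i)) ((f ^^ i) x)"
      by (simp add: funpow_add eq)
    also have "\<dots> = (f ^^ (p - i + i)) x"
      by (metis comp_apply funpow_add)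
    finally have d: "(f ^^ d) x = x"
      using ij per by simp
    have "\<not> p dvd d"
      using ij by (simp add: d_def nat_dvd_not_less)
    then have "coprime d p"
      using p prime_imp_coprime coprime_commute by blast
    then obtain a b where ab: "d * a = p * b + 1"
      using coprime_bezout_strong[of d p] p not_prime_1 by blast
    have "(f ^^ (d * a)) x = x"
      using funpow_mod_eq[OF d, of "d * a"] by simp
    moreover have "(f ^^ (p * b)) x = x"
      using funpow_mod_eq[OF per, of "p * b"] by simp
    ultimately show False
      using moved ab by simp
  qed
  show ?thesis
    using no_shorter[of i j] no_shorter[of j i] i j eq by (metis nat_neq_iff)
qed

text \<open>The moved points are a union of orbits, and by the previous lemma each such orbit has exactly
  \<open>p\<close> elements.\<close>

lemma prime_dvd_card_moved:
  assumes p: "prime p" and fin: "finite S"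
    and closed: "\<And>x. x \<in> S \<Longrightarrow> f x \<in> S" and per: "\<And>x. x \<in> S \<Longrightarrow> (f ^^ p) x = x"
  shows "p dvd card {x \<in> S. f x \<noteq> x}"
proof -
  define M where "M = {x \<in> S. f x \<noteq> x}"
  define r where "r = {(x, y). x \<in> M \<and> (\<exists>i. y = (f ^^ i) x)}"
  have pow_S: "(f ^^ i) x \<in> S" if "x \<in> S" for i x
    using that by (induction i) (auto intro: closed)
  have p0: "p > 0"
    using p by (simp add: prime_gt_0_nat)
  have returns: "\<exists>j. (f ^^ j) ((f ^^ i) x) = x" if "x \<in> S" for i x
  proof -
    have "(f ^^ (p * i - i + i)) x = x"
      using funpow_mod_eq[OF per[OF that], of "p * i"] p0 by simp
    then show ?thesis
      by (metis comp_apply funpow_add)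
  qed
  have pow_M: "(f ^^ i) x \<in> M" if "x \<in> M" for i x
  proof -
    have x: "x \<in> S" "f x \<noteq> x"
      using that by (auto simp: M_def)
    have "f ((f ^^ i) x) \<noteq> (f ^^ i) x"
    proof
      assume stuck: "f ((f ^^ i) x) = (f ^^ i) x"
      obtain j where j: "(f ^^ j) ((f ^^ i) x) = x"
        using returns[OF x(1)] by blast
      have "(f ^^ j) ((f ^^ i) x) = (f ^^ i) x" for j
        by (induction j) (simp_all add: stuck)
      then show False
        using j stuck x(2) by metis
    qed
    then show ?thesis
      using pow_S[OF x(1)] by (simp add: M_def)
  qed
  have "equiv M r"
  proof (rule equivI)
    show "r \<subseteq> M \<times> M"
      using pow_M by (auto simp: r_def)
    show "refl_on M r"
      by (auto simp: refl_on_def r_def intro: exI[of _ 0])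
    show "sym r"
    proof (rule symI)
      fix x y
      assume "(x, y) \<in> r"
      then obtain i where x: "x \<in> M" and y: "y = (f ^^ i) x"
        by (auto simp: r_def)
      obtain j where j: "(f ^^ j) y = x"
        using returns[of x i] x y by (auto simp: M_def)
      then show "(y, x) \<in> r"
        using pow_M[OF x, of i] y j unfolding r_def by (simp, metis)
    qed
    show "trans r"
    proof (rule transI)
      fix x y z
      assume "(x, y) \<in> r" "(y, z) \<in> r"
      then obtain i j where x: "x \<in> M" and "y = (f ^^ i) x" "z = (f ^^ j) y"
        by (auto simp: r_def)
      then have "z = (f ^^ (j + i)) x"
        by (simp add: funpow_add)
      then show "(x, z) \<in> r"
        using x unfolding r_def by blast
    qed
  qed
  moreover have "p dvd card X" if X: "X \<in> M // r" for X
  proof -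
    obtain x where x: "x \<in> M" and X_eq: "X = r `` {x}"
      using X unfolding quotient_def by blast
    have "X = (\<lambda>i. (f ^^ i) x) ` {..<p}"
    proof -
      have "(f ^^ i) x \<in> (\<lambda>i. (f ^^ i) x) ` {..<p}" for i
        using funpow_mod_eq[OF per, of x i] x p0
        by (intro image_eqI[of _ _ "i mod p"]) (auto simp: M_def)
      then show ?thesis
        using x by (auto simp: X_eq r_def)
    qed
    moreover have "inj_on (\<lambda>i. (f ^^ i) x) {..<p}"
      using prime_period_funpow_inj[OF p per, of x] x by (auto simp: inj_on_def M_def)
    ultimately show ?thesis
      by (simp add: card_image)
  qed
  ultimately show ?thesis
    using equiv_imp_dvd_card[of M r p] fin by (simp add: M_def)
qed

lemma image_funpow:
  fixes f :: "'a \<Rightarrow> 'a"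
  shows "((`) f ^^ n) A = (f ^^ n) ` A"
  by (induction n) (auto simp: image_image)


section \<open>Generalized quadrangles whose lines are point sets\<close>

text \<open>Identifying a line with its set of points turns the number of common points of two lines into
  the cardinality of an intersection and the action of a permutation on lines into the image
  operator. In \<open>projection\<close> only the line is asked to be unique; uniqueness of its meeting point
  with \<open>b\<close> is already contained in \<open>line_unique\<close>.\<close>

locale quadrangle =
  fixes P :: "'a set" and B :: "'a set set" and s t :: nat
  assumes finite_P: "finite P" and nonempty_P: "P \<noteq> {}"
    and s_pos: "0 < s" and t_pos: "0 < t"
    and line_subset: "b \<in> B \<Longrightarrow> b \<subseteq> P"
    and card_line: "b \<in> B \<Longrightarrow> card b = s + 1"
    and card_pencil: "x \<in> P \<Longrightarrow> card {b \<in> B. x \<in> b} = t + 1"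
    and line_unique: "\<lbrakk>b \<in> B; c \<in> B; x \<in> b; x \<in> c; y \<in> b; y \<in> c; x \<noteq> y\<rbrakk> \<Longrightarrow> b = c"
    and projection: "\<lbrakk>x \<in> P; b \<in> B; x \<notin> b\<rbrakk> \<Longrightarrow> \<exists>!c. c \<in> B \<and> x \<in> c \<and> c \<inter> b \<noteq> {}"
begin

lemma finite_B: "finite B"
  using finite_P line_subset finite_subset[of B "Pow P"] by auto

lemma finite_line: "b \<in> B \<Longrightarrow> finite b"
  using card_line card.infinite by force

lemma card_inter_distinct:
  assumes "b \<in> B" "c \<in> B" "b \<noteq> c"
  shows "card (b \<inter> c) = (if b \<inter> c = {} then 0 else 1)"
proof (cases "b \<inter> c = {}")
  case False
  then obtain x where "x \<in> b \<inter> c"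
    by blast
  then have "b \<inter> c = {x}"
    using line_unique assms by blast
  then show ?thesis
    by simp
qed simp

text \<open>With \<open>N\<close> the point-line incidence matrix and \<open>J\<close> the all-one matrix, this is the identity
  \<open>N N\<^sup>T N = J + (s + t) N\<close>. Off \<open>l\<close>, the projection axiom provides one line with one
  common point; on \<open>l\<close>, the line \<open>l\<close> contributes \<open>s + 1\<close> and the \<open>t\<close> others contribute \<open>1\<close> each.\<close>

lemma sum_card_inter_pencil:
  assumes x: "x \<in> P" and l: "l \<in> B"
  shows "(\<Sum>c\<in>{c \<in> B. x \<in> c}. card (c \<inter> l)) = 1 + (s + t) * of_bool (x \<in> l)"
proof (cases "x \<in> l")
  case True
  have "card (c \<inter> l) = 1" if "c \<in> {c \<in> B. x \<in> c} - {l}" for c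
    using that True card_inter_distinct[of c l] l by auto
  then have "(\<Sum>c\<in>{c \<in> B. x \<in> c} - {l}. card (c \<inter> l)) = card ({c \<in> B. x \<in> c} - {l})"
    by simp
  also have "\<dots> = t"
    using True l card_pencil[OF x] by (subst card_Diff_singleton) auto
  finally show ?thesis
    using True l card_line[OF l] finite_B sum.remove[of "{c \<in> B. x \<in> c}" l "\<lambda>c. card (c \<inter> l)"]
    by simp
next
  case False
  obtain d where d: "d \<in> B" "x \<in> d" "d \<inter> l \<noteq> {}"
    and uniq: "\<And>c. c \<in> B \<Longrightarrow> x \<in> c \<Longrightarrow> c \<inter> l \<noteq> {} \<Longrightarrow> c = d"
    using projection[OF x l False] by blast
  have "(\<Sum>c\<in>{c \<in> B. x \<in> c}. card (c \<inter> l)) = (\<Sum>c\<in>{d}. card (c \<inter> l))"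
  proof (rule sum.mono_neutral_right)
    show "\<forall>c\<in>{c \<in> B. x \<in> c} - {d}. card (c \<inter> l) = 0"
      using uniq by fastforce
  qed (use d finite_B in auto)
  also have "\<dots> = 1"
    using card_inter_distinct[of d l] d l False by auto
  finally show ?thesis
    using False by simp
qed

text \<open>Double counting of the flags with point in \<open>A\<close>, weighted by a function of the line.\<close>

lemma sum_card_inter_mult:
  assumes "A \<subseteq> P"
  shows "(\<Sum>c\<in>B. card (c \<inter> A) * g c) = (\<Sum>x\<in>A. \<Sum>c\<in>{c \<in> B. x \<in> c}. g c)"
proof -
  have fin: "finite A"
    using assms finite_P finite_subset by blast
  have "card (c \<inter> A) * g c = (\<Sum>x\<in>A. if x \<in> c then g c else 0)" for c
    using fin by (simp add: sum.If_cases Int_def conj_commute)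
  then have "(\<Sum>c\<in>B. card (c \<inter> A) * g c) = (\<Sum>x\<in>A. \<Sum>c\<in>B. if x \<in> c then g c else 0)"
    by (simp add: sum.swap[of _ A B])
  then show ?thesis
    using finite_B by (simp add: sum.inter_filter)
qed

lemma sum_card_inter:
  assumes l: "l \<in> B"
  shows "(\<Sum>c\<in>B. card (c \<inter> l)) = (s + 1) * (t + 1)"
  using sum_card_inter_mult[OF line_subset[OF l], of "\<lambda>_. 1"] card_pencil line_subset[OF l] card_line[OF l]
  by (simp add: subset_eq)

text \<open>For \<open>M = N\<^sup>T N\<close> this is \<open>M\<^sup>2 = (s + 1) J + (s + t) M\<close>, obtained by multiplying the
  identity for \<open>N N\<^sup>T N\<close> by \<open>N\<^sup>T\<close>.\<close>

lemma sum_card_inter_inter: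
  assumes l: "l \<in> B" and m: "m \<in> B"
  shows "(\<Sum>c\<in>B. card (c \<inter> l) * card (c \<inter> m)) = (s + 1) + (s + t) * card (l \<inter> m)"
proof -
  have "(\<Sum>c\<in>B. card (c \<inter> l) * card (c \<inter> m)) = (\<Sum>x\<in>l. 1 + (s + t) * of_bool (x \<in> m))"
    using sum_card_inter_pencil[OF _ m] line_subset[OF l]
    by (subst sum_card_inter_mult[OF line_subset[OF l]]) (intro sum.cong, auto)
  also have "\<dots> = (s + 1) + (s + t) * card (l \<inter> m)"
    using card_line[OF l] finite_line[OF l]
    by (subst sum.distrib) (simp add: sum_distrib_left[symmetric] of_bool_def sum.If_cases Int_def)
  finally show ?thesis .
qed

lemma B_nonempty: "B \<noteq> {}"
proof -
  obtain x where "x \<in> P" using nonempty_P by blast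
  then have "card {b \<in> B. x \<in> b} \<noteq> 0"
    using card_pencil by simp
  then show ?thesis
    by force
qed

text \<open>Summing \<open>sum_card_inter_pencil\<close> over all points, for one line, leaves \<open>card P\<close> as the only
  unknown.\<close>

lemma card_P: "card P = (s + 1) * (s * t + 1)"
proof -
  obtain l where l: "l \<in> B"
    using B_nonempty by blast
  have "(s + 1) * ((s + 1) * (t + 1)) = (\<Sum>c\<in>B. card (c \<inter> P) * card (c \<inter> l))"
    using card_line line_subset
    by (subst sum_card_inter[OF l, symmetric], subst sum_distrib_left) (auto intro!: sum.cong simp: Int_absorb2)
  also have "\<dots> = (\<Sum>x\<in>P. 1 + (s + t) * of_bool (x \<in> l))"
    using sum_card_inter_pencil[OF _ l]
    by (subst sum_card_inter_mult) (auto intro!: sum.cong)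
  also have "\<dots> = card P + (s + t) * card (P \<inter> l)"
    using finite_P
    by (subst sum.distrib) (simp add: sum_distrib_left[symmetric] of_bool_def sum.If_cases Int_def)
  also have "P \<inter> l = l"
    using line_subset[OF l] by blast
  finally show ?thesis
    using card_line[OF l] by (simp add: algebra_simps)
qed

lemma card_B: "card B = (t + 1) * (s * t + 1)"
proof -
  have "(s + 1) * card B = (\<Sum>c\<in>B. card (c \<inter> P) * 1)"
    using card_line line_subset by (simp add: Int_absorb2)
  also have "\<dots> = card P * (t + 1)"
    using card_pencil by (subst sum_card_inter_mult) simp_all
  also have "\<dots> = (s + 1) * ((t + 1) * (s * t + 1))"
    by (simp only: card_P ac_simps)
  finally show ?thesis
    by (simp only: mult_cancel1) simp
qed


section \<open>The bound on complete bipartite concurrency\<close>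

text \<open>The matrix \<open>J - (t + 1) M + (t + 1)(s + t) I\<close>, where \<open>M\<close> has the entries \<open>card (k \<inter> l)\<close>. It is
  scaled so that its entries are \<open>t\<^sup>2\<close> on the diagonal, \<open>- t\<close> for concurrent lines and \<open>1\<close> for
  disjoint ones. The matrix \<open>M\<close> has the eigenvalue \<open>(s + 1)(t + 1)\<close> on constant vectors and
  otherwise only \<open>s + t\<close> and \<open>0\<close>; the first two eigenspaces are annihilated, and what remains is
  \<open>(t + 1)(s + t)\<close> times the orthogonal projection onto the kernel of \<open>M\<close>. Positivity of this
  projection is what bounds configurations of lines.\<close>

definition gram :: "'a set \<Rightarrow> 'a set \<Rightarrow> real" where
  "gram k l = 1 - (real t + 1) * card (k \<inter> l) + (real t + 1) * (real s + real t) * of_bool (k = l)"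

lemma gram_self: "l \<in> B \<Longrightarrow> gram l l = (real t)\<^sup>2"
  by (simp add: gram_def card_line algebra_simps power2_eq_square)

lemma gram_disjoint: "l \<in> B \<Longrightarrow> m \<in> B \<Longrightarrow> l \<noteq> m \<Longrightarrow> l \<inter> m = {} \<Longrightarrow> gram l m = 1"
  by (simp add: gram_def)

lemma gram_concurrent: "l \<in> B \<Longrightarrow> m \<in> B \<Longrightarrow> l \<noteq> m \<Longrightarrow> l \<inter> m \<noteq> {} \<Longrightarrow> gram l m = - real t"
  by (simp add: gram_def card_inter_distinct)

text \<open>A symmetric matrix that equals a positive multiple of its own square is positive semidefinite:
  its quadratic form is a multiple of a sum of squares. The coefficient of \<open>card (l \<inter> m)\<close>
  and the constant term match because of the value of \<open>card B\<close>.\<close>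

lemma gram_square:
  assumes l: "l \<in> B" and m: "m \<in> B"
  shows "(\<Sum>k\<in>B. gram k l * gram k m) = (real t + 1) * (real s + real t) * gram l m"
proof -
  define w where "w = (real t + 1) * (real s + real t)"
  let ?n = "\<lambda>k l. real (card (k \<inter> l))"
  have K: "gram k b = 1 - (real t + 1) * ?n k b + w * of_bool (k = b)" for k b
    by (simp add: gram_def w_def)
  have S1: "(\<Sum>k\<in>B. ?n k b) = (real s + 1) * (real t + 1)" if "b \<in> B" for b
    using arg_cong[OF sum_card_inter[OF that], of real] by (simp add: algebra_simps)
  have S2: "(\<Sum>k\<in>B. ?n k l * ?n k m) = (real s + 1) + (real s + real t) * ?n l m"
    using arg_cong[OF sum_card_inter_inter[OF l m], of real] by simp
  have D: "(\<Sum>k\<in>B. of_bool (k = b) * g k) = g b" if "b \<in> B" for b and g :: "'a set \<Rightarrow> real"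
    using that finite_B by (simp add: of_bool_def if_distrib[of "\<lambda>x. x * _"] sum.delta cong: if_cong)
  have "(\<Sum>k\<in>B. gram k l * gram k m) = (\<Sum>k\<in>B. 1 - (real t + 1) * ?n k l - (real t + 1) * ?n k m
      + (real t + 1)\<^sup>2 * (?n k l * ?n k m) + w * (of_bool (k = l) * gram k m)
      + w * (of_bool (k = m) * (1 - (real t + 1) * ?n k l)))"
    \<comment> \<open>Only one factor is expanded next to each delta, so that the deltas evaluate to \<open>gram l m\<close> itself.\<close>
    by (rule sum.cong, rule refl, simp only: K) (simp add: algebra_simps power2_eq_square)
  also have "\<dots> = real (card B) - 2 * (real t + 1) * ((real s + 1) * (real t + 1))
      + (real t + 1)\<^sup>2 * ((real s + 1) + (real s + real t) * ?n l m)
      + w * gram l m + w * (1 - (real t + 1) * ?n m l)"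
    by (simp add: sum.distrib sum_subtractf sum_distrib_left[symmetric] S1 l m S2 D)
  also have "\<dots> = w * gram l m"
    by (simp add: card_B w_def Int_commute[of m l] power2_eq_square) (simp add: algebra_simps)
  finally show ?thesis
    by (simp add: w_def)
qed

lemma sum_gram_product:
  assumes "A \<subseteq> B" "C \<subseteq> B"
  shows "(\<Sum>k\<in>B. (\<Sum>l\<in>A. gram k l) * (\<Sum>m\<in>C. gram k m))
    = (real t + 1) * (real s + real t) * (\<Sum>l\<in>A. \<Sum>m\<in>C. gram l m)"
proof -
  have "(\<Sum>k\<in>B. (\<Sum>l\<in>A. gram k l) * (\<Sum>m\<in>C. gram k m))
      = (\<Sum>k\<in>B. \<Sum>l\<in>A. \<Sum>m\<in>C. gram k l * gram k m)"
    by (simp add: sum_product)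
  also have "\<dots> = (\<Sum>l\<in>A. \<Sum>m\<in>C. \<Sum>k\<in>B. gram k l * gram k m)"
    by (subst sum.swap) (simp add: sum.swap[of _ C B])
  also have "\<dots> = (\<Sum>l\<in>A. \<Sum>m\<in>C. (real t + 1) * (real s + real t) * gram l m)"
    using assms by (intro sum.cong refl gram_square) auto
  finally show ?thesis
    by (simp add: sum_distrib_left)
qed

text \<open>With \<open>u\<close> and \<open>v\<close> the images of the indicator vectors of \<open>A\<close> and \<open>C\<close>, the inner products of
  \<open>u\<close> and \<open>v\<close> are \<open>(t + 1)(s + t)\<close> times the three sums in the claim; it expresses that
  \<open>a v - b u\<close>, a multiple of the component of \<open>v\<close> orthogonal to \<open>u\<close>, has nonnegative square norm.\<close>

lemma gram_cauchy_schwarz: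
  assumes A: "A \<subseteq> B" and C: "C \<subseteq> B" and pos: "(\<Sum>l\<in>A. \<Sum>m\<in>A. gram l m) > 0"
  shows "(\<Sum>l\<in>A. \<Sum>m\<in>C. gram l m)\<^sup>2 \<le> (\<Sum>l\<in>A. \<Sum>m\<in>A. gram l m) * (\<Sum>l\<in>C. \<Sum>m\<in>C. gram l m)"
proof -
  define w where "w = (real t + 1) * (real s + real t)"
  define a where "a = (\<Sum>l\<in>A. \<Sum>m\<in>A. gram l m)"
  define b where "b = (\<Sum>l\<in>A. \<Sum>m\<in>C. gram l m)"
  define c where "c = (\<Sum>l\<in>C. \<Sum>m\<in>C. gram l m)"
  define u where "u k = (\<Sum>l\<in>A. gram k l)" for k
  define v where "v k = (\<Sum>l\<in>C. gram k l)" for k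
  have "0 \<le> (\<Sum>k\<in>B. (a * v k - b * u k)\<^sup>2)"
    by (simp add: sum_nonneg)
  also have "\<dots> = (\<Sum>k\<in>B. a\<^sup>2 * (v k * v k) - 2 * a * b * (u k * v k) + b\<^sup>2 * (u k * u k))"
    by (rule sum.cong) (auto simp: algebra_simps power2_eq_square)
  also have "\<dots> = a\<^sup>2 * (w * c) - 2 * a * b * (w * b) + b\<^sup>2 * (w * a)"
    using sum_gram_product[OF A A] sum_gram_product[OF A C] sum_gram_product[OF C C]
    by (simp add: sum.distrib sum_subtractf sum_distrib_left[symmetric] u_def v_def a_def b_def c_def w_def)
  also have "\<dots> = (w * a) * (a * c - b\<^sup>2)"
    by (simp add: algebra_simps power2_eq_square)
  finally have "0 \<le> (w * a) * (a * c - b\<^sup>2)" .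
  moreover have "0 < w * a"
    using pos t_pos by (simp add: w_def a_def)
  ultimately show ?thesis
    by (simp add: zero_le_mult_iff a_def b_def c_def)
qed

lemma sum_gram_partial_spread:
  assumes A: "A \<subseteq> B" and dis: "pairwise disjnt A"
  shows "(\<Sum>l\<in>A. \<Sum>m\<in>A. gram l m) = real (card A) * ((real t)\<^sup>2 + real (card A) - 1)"
proof -
  have fin: "finite A"
    using A finite_B finite_subset by blast
  have "(\<Sum>m\<in>A. gram l m) = (real t)\<^sup>2 + real (card A) - 1" if l: "l \<in> A" for l
  proof -
    have "(\<Sum>m\<in>A - {l}. gram l m) = (\<Sum>m\<in>A - {l}. 1)"
    proof (rule sum.cong)
      fix m
      assume m: "m \<in> A - {l}"
      then have "l \<inter> m = {}"
        using dis l by (auto simp: pairwise_def disjnt_def)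
      then show "gram l m = 1"
        using gram_disjoint[of l m] A l m by auto
    qed simp
    also have "\<dots> = real (card A) - 1"
      using card.remove[OF fin l] by simp
    finally show ?thesis
      using sum.remove[OF fin l, of "gram l"] gram_self[of l] A l by auto
  qed
  then show ?thesis
    by simp
qed

text \<open>With \<open>m\<close> and \<open>n\<close> the two sizes, Cauchy--Schwarz reads
  \<open>m n t\<^sup>2 \<le> (t\<^sup>2 + m - 1) (t\<^sup>2 + n - 1)\<close> after division by \<open>m n\<close>, and the difference of the
  two sides is \<open>(t\<^sup>2 - 1) (t\<^sup>2 - (m - 1) (n - 1))\<close>. Dividing by \<open>t\<^sup>2 - 1\<close> is
  where \<open>t > 1\<close> enters.\<close>

theorem complete_bipartite_bound:
  assumes t: "1 < t" and X: "X \<subseteq> B" "pairwise disjnt X" and Y: "Y \<subseteq> B" "pairwise disjnt Y"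
    and XY: "X \<inter> Y = {}" and meet: "\<And>x y. x \<in> X \<Longrightarrow> y \<in> Y \<Longrightarrow> x \<inter> y \<noteq> {}"
  shows "(card X - 1) * (card Y - 1) \<le> t\<^sup>2"
proof (cases "X = {} \<or> Y = {}")
  case False
  define m where "m = real (card X)"
  define n where "n = real (card Y)"
  define T where "T = (real t)\<^sup>2"
  have mn: "m \<ge> 1" "n \<ge> 1"
    using False finite_subset[OF X(1) finite_B] finite_subset[OF Y(1) finite_B] card_gt_0_iff[of X] card_gt_0_iff[of Y]
    unfolding m_def n_def by linarith+
  have T: "T > 1"
    using t by (simp add: T_def)
  have "gram x y = - real t" if "x \<in> X" "y \<in> Y" for x y
    using that X Y XY meet[OF that] by (intro gram_concurrent) auto
  then have "(\<Sum>x\<in>X. \<Sum>y\<in>Y. gram x y) = - (m * n * real t)"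
    by (simp add: m_def n_def)
  moreover have "m * (T + m - 1) > 0"
    using mn T by simp
  ultimately have "(m * n)\<^sup>2 * T \<le> (m * (T + m - 1)) * (n * (T + n - 1))"
    using gram_cauchy_schwarz[OF X(1) Y(1)] sum_gram_partial_spread[OF X] sum_gram_partial_spread[OF Y]
    by (simp add: m_def n_def T_def power_mult_distrib)
  then have "(m * n) * ((m * n) * T) \<le> (m * n) * ((T + m - 1) * (T + n - 1))"
    by (simp add: power2_eq_square ac_simps)
  moreover have "m * n > 0"
    using mn by simp
  ultimately have "m * n * T \<le> (T + m - 1) * (T + n - 1)"
    using mult_le_cancel_left_pos by blast
  then have "(T - 1) * ((m - 1) * (n - 1)) \<le> (T - 1) * T"
    by (simp add: algebra_simps)
  then have "(m - 1) * (n - 1) \<le> T"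
    using T by simp
  moreover have "real ((card X - 1) * (card Y - 1)) = (m - 1) * (n - 1)"
    using mn by (simp add: m_def n_def of_nat_diff)
  ultimately have "real ((card X - 1) * (card Y - 1)) \<le> real (t\<^sup>2)"
    by (simp add: T_def)
  then show ?thesis
    by (simp only: of_nat_le_iff)
qed auto

text \<open>As there are no triangles, the points collinear with two given points of a line are exactly the
  points of that line. A line is thus determined by collinearity alone, and bijections that
  preserve collinearity map lines to lines.\<close>

lemma image_line_of_collinearity:
  assumes f: "bij_betw f P P"
    and coll: "\<And>x y. x \<in> P \<Longrightarrow> y \<in> P \<Longrightarrow>
      (\<exists>b\<in>B. f x \<in> b \<and> f y \<in> b) \<longleftrightarrow> (\<exists>b\<in>B. x \<in> b \<and> y \<in> b)"
    and b: "b \<in> B"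
  shows "f ` b \<in> B"
proof -
  let ?C = "\<lambda>x y. \<exists>b\<in>B. x \<in> b \<and> y \<in> b"
  have char: "b = {z \<in> P. ?C z x \<and> ?C z y}" if b: "b \<in> B" and xy: "x \<in> b" "y \<in> b" "x \<noteq> y" for b x y
  proof (intro equalityI subsetI)
    fix z
    assume "z \<in> {z \<in> P. ?C z x \<and> ?C z y}"
    then obtain c d where z: "z \<in> P" and c: "c \<in> B" "z \<in> c" "x \<in> c" and d: "d \<in> B" "z \<in> d" "y \<in> d"
      by blast
    show "z \<in> b"
    proof (rule ccontr)
      assume "z \<notin> b"
      then have "c = d"
        using projection[OF z b] c d xy by blast
      then have "c = b"
        using line_unique[OF c(1) b c(3) xy(1)] d xy by blast
      then show False
        using c \<open>z \<notin> b\<close> by blast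
    qed
  qed (use line_subset b xy in blast)
  obtain x y where xy: "x \<in> b" "y \<in> b" "x \<noteq> y"
  proof -
    have "\<not> card b \<le> Suc 0"
      using card_line[OF b] s_pos by simp
    then show ?thesis
      using that card_le_Suc0_iff_eq[OF finite_line[OF b]] by blast
  qed
  have P: "x \<in> P" "y \<in> P"
    using xy line_subset[OF b] by auto
  obtain c where c: "c \<in> B" "f x \<in> c" "f y \<in> c"
    using coll[OF P] b xy by blast
  have ne: "f x \<noteq> f y"
    using f xy P by (auto simp: bij_betw_def inj_on_def)
  have "f ` {z \<in> P. ?C z x \<and> ?C z y} = {z \<in> P. ?C z (f x) \<and> ?C z (f y)}"
  proof (intro equalityI subsetI)
    fix z
    assume z: "z \<in> {z \<in> P. ?C z (f x) \<and> ?C z (f y)}"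
    then obtain z' where z': "z' \<in> P" "z = f z'"
      using f by (auto simp: bij_betw_def)
    then show "z \<in> f ` {z \<in> P. ?C z x \<and> ?C z y}"
      using z coll[OF z'(1) P(1)] coll[OF z'(1) P(2)] by auto
  next
    fix z
    assume "z \<in> f ` {z \<in> P. ?C z x \<and> ?C z y}"
    then obtain z' where z': "z' \<in> P" "z = f z'" "?C z' x" "?C z' y"
      by auto
    then show "z \<in> {z \<in> P. ?C z (f x) \<and> ?C z (f y)}"
      using f coll[OF z'(1) P(1)] coll[OF z'(1) P(2)] by (auto simp: bij_betw_def)
  qed
  then show ?thesis
    using char[OF b xy] char[OF c ne] c by simp
qed

end


section \<open>Automorphisms of prime order s + 1\<close>

locale prime_automorphism = quadrangle +
  fixes f :: "'a \<Rightarrow> 'a"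
  assumes bij_f: "bij_betw f P P"
    and line_image: "b \<in> B \<Longrightarrow> f ` b \<in> B"
    and period: "x \<in> P \<Longrightarrow> (f ^^ (s + 1)) x = x"
    and nontrivial: "\<exists>x\<in>P. f x \<noteq> x"
    and prime_s1: "prime (s + 1)"
    and t_less_s: "t < s" and t_gt1: "1 < t"
begin

lemma point_image: "x \<in> P \<Longrightarrow> f x \<in> P"
  using bij_f by (auto simp: bij_betw_def)

lemma line_period: "b \<in> B \<Longrightarrow> ((`) f ^^ (s + 1)) b = b"
  using period line_subset[of b] image_cong[of b b "f ^^ (s + 1)" id] unfolding image_funpow
  by (auto simp: subset_eq)

lemma line_image_pow: "b \<in> B \<Longrightarrow> (f ^^ i) ` b \<in> B"
  unfolding image_funpow[symmetric] by (induction i) (auto intro: line_image)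

lemma fixed_line_pow: "f ` b = b \<Longrightarrow> (f ^^ i) ` b = b"
  unfolding image_funpow[symmetric] by (induction i) auto

lemma line_image_pow_inj:
  assumes "b \<in> B" "c \<in> B" "(f ^^ i) ` b = (f ^^ i) ` c"
  shows "b = c"
proof -
  have "inj_on (f ^^ i) P"
    using bij_betw_funpow[OF bij_f] by (simp add: bij_betw_def)
  then show ?thesis
    using assms inj_on_image_eq_iff line_subset by metis
qed

lemma dvd_less_imp_empty:
  assumes "s + 1 dvd card A" "finite A" "card A < s + 1"
  shows "A = {}"
  using assms dvd_imp_le[of "s + 1" "card A"] by (cases "A = {}") (auto simp: card_gt_0_iff)

text \<open>The number of moved lines in the pencil is a multiple of \<open>s + 1\<close> not exceeding \<open>t + 1\<close>.\<close>

lemma lines_through_fixed_point: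
  assumes x: "x \<in> P" "f x = x" and b: "b \<in> B" "x \<in> b"
  shows "f ` b = b"
proof -
  let ?S = "{b \<in> B. x \<in> b}"
  have "s + 1 dvd card {b \<in> ?S. f ` b \<noteq> b}"
    using x line_image line_period finite_B
    by (intro prime_dvd_card_moved[OF prime_s1]) (auto, metis imageI)
  moreover have "card {b \<in> ?S. f ` b \<noteq> b} \<le> t + 1"
    unfolding card_pencil[OF x(1), symmetric] using finite_B by (intro card_mono) auto
  ultimately have "{b \<in> ?S. f ` b \<noteq> b} = {}"
    using t_less_s finite_B by (intro dvd_less_imp_empty) auto
  then show ?thesis
    using b by blast
qed

text \<open>The number of moved points on the line is a multiple of \<open>s + 1\<close>, and \<open>x\<close> is not among
  them.\<close>

lemma points_on_fixed_line:
  assumes b: "b \<in> B" "f ` b = b" and x: "x \<in> b" "f x = x" and y: "y \<in> b"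
  shows "f y = y"
proof -
  have "s + 1 dvd card {z \<in> b. f z \<noteq> z}"
    using b line_subset period finite_line by (intro prime_dvd_card_moved[OF prime_s1]) auto
  moreover have "card {z \<in> b. f z \<noteq> z} < s + 1"
    using x card_line[OF b(1)] finite_line[OF b(1)] psubset_card_mono[of b "{z \<in> b. f z \<noteq> z}"]
    by auto
  ultimately have "{z \<in> b. f z \<noteq> z} = {}"
    using finite_line[OF b(1)] by (intro dvd_less_imp_empty) auto
  then show ?thesis
    using y by blast
qed

text \<open>Being fixed spreads along lines, and every point is reached from \<open>x\<close> in at most two steps.\<close>

lemma no_fixed_point:
  assumes x: "x \<in> P"
  shows "f x \<noteq> x"
proof
  assume fx: "f x = x"
  have spread: "f z = z" if "y \<in> P" "f y = y" "b \<in> B" "y \<in> b" "z \<in> b" for b y z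
    using points_on_fixed_line[of b y z] lines_through_fixed_point[of y b] that by blast
  have "{b \<in> B. x \<in> b} \<noteq> {}"
    using card_pencil[OF x] by (metis add_is_0 card.empty one_neq_zero)
  then obtain b where b: "b \<in> B" "x \<in> b"
    by blast
  have "f y = y" if y: "y \<in> P" for y
  proof (cases "y \<in> b")
    case False
    then obtain c z where "c \<in> B" "y \<in> c" "z \<in> c" "z \<in> b"
      using projection[OF y b(1)] by blast
    then show ?thesis
      using spread[of x b z] spread[of z c y] x fx b line_subset by blast
  qed (use spread[of x b y] x fx b in blast)
  then show False
    using nontrivial by blast
qed

abbreviation fixed_lines :: "'a set set" where
  "fixed_lines \<equiv> {b \<in> B. f ` b = b}"

text \<open>A common point of two fixed lines would be mapped to a common point, hence fixed.\<close>

lemma fixed_lines_disjoint: "pairwise disjnt fixed_lines"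
proof (rule pairwiseI)
  fix b c
  assume bc: "b \<in> fixed_lines" "c \<in> fixed_lines" "b \<noteq> c"
  show "disjnt b c"
  proof (rule ccontr)
    assume "\<not> disjnt b c"
    then obtain x where x: "x \<in> b" "x \<in> c"
      by (auto simp: disjnt_def)
    then have "f x \<in> b" "f x \<in> c" "f x \<noteq> x"
      using bc no_fixed_point[of x] line_subset by auto
    then show False
      using line_unique[of b c x "f x"] x bc by auto
  qed
qed

text \<open>Modulo \<open>s + 1\<close> the number of fixed lines is \<open>card B = (t + 1) (s t + 1)\<close>, which is
  \<open>(t + 1) (1 - t)\<close> because \<open>s\<close> is congruent to \<open>-1\<close>.\<close>

lemma dvd_card_fixed_lines: "s + 1 dvd card fixed_lines + t\<^sup>2 - 1"
proof -
  let ?M = "{b \<in> B. f ` b \<noteq> b}"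
  have "card B = card fixed_lines + card ?M"
    using finite_B by (subst card_Un_disjoint[symmetric]) (auto intro!: arg_cong[of _ _ card])
  moreover have "(t + 1) * (s * t + 1) + t\<^sup>2 = (s + 1) * (t\<^sup>2 + t) + 1"
    by (simp add: algebra_simps power2_eq_square)
  moreover have "t\<^sup>2 \<ge> 1"
    using t_pos by simp
  ultimately have total: "card fixed_lines + t\<^sup>2 - 1 + card ?M = (s + 1) * (t\<^sup>2 + t)"
    unfolding card_B by linarith
  have "s + 1 dvd card ?M"
    using line_image line_period finite_B by (intro prime_dvd_card_moved[OF prime_s1]) auto
  moreover have "s + 1 dvd card fixed_lines + t\<^sup>2 - 1 + card ?M"
    unfolding total by (rule dvd_triv_left)
  ultimately show ?thesis
    by (simp only: dvd_add_left_iff)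
qed

text \<open>Otherwise the prime \<open>s + 1\<close> would divide one of the positive numbers \<open>t - 1\<close> and \<open>t + 1\<close>,
  both smaller than \<open>s + 1\<close>.\<close>

lemma fixed_lines_nonempty: "fixed_lines \<noteq> {}"
proof
  assume "fixed_lines = {}"
  then have "s + 1 dvd t\<^sup>2 - 1"
    using dvd_card_fixed_lines by (simp del: Collect_empty_eq)
  also have "t\<^sup>2 - 1 = (t - 1) * (t + 1)"
    by (simp add: power2_eq_square algebra_simps)
  finally have "s + 1 dvd t - 1 \<or> s + 1 dvd t + 1"
    using prime_s1 prime_dvd_mult_iff by blast
  then show False
    using t_gt1 t_less_s by (auto dest!: dvd_imp_le)
qed

text \<open>Fix a point \<open>x\<close> on a fixed line \<open>l\<close>. By pigeonhole, some line \<open>m\<close> through \<open>x\<close> meets a set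
  \<open>Z\<close> of at least \<open>(g - 1) / t\<close> of the \<open>g - 1\<close> fixed lines other than \<open>l\<close>. The bound on complete
  bipartite configurations, applied to the \<open>s + 1\<close> images of \<open>m\<close> on one side and to \<open>l\<close> together
  with \<open>Z\<close> on the other, gives the claim for \<open>n = card Z\<close>.\<close>

lemma fixed_lines_bound: "\<exists>n. s * n \<le> t\<^sup>2 \<and> card fixed_lines \<le> t * n + 1"
proof -
  obtain l where l: "l \<in> B" "f ` l = l"
    using fixed_lines_nonempty by auto
  have "l \<noteq> {}"
    using card_line[OF l(1)] by auto
  then obtain x where x: "x \<in> l"
    by blast
  have xP: "x \<in> P"
    using x l line_subset by blast
  define others where "others = fixed_lines - {l}"
  define T where "T = {c \<in> B. x \<in> c} - {l}"
  have fin: "finite others" "finite T"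
    using finite_B by (auto simp: others_def T_def)
  have card_T: "card T = t"
    using card_pencil[OF xP] x l finite_B by (simp add: T_def card_Diff_singleton)
  define proj where "proj g = (THE c. c \<in> B \<and> x \<in> c \<and> c \<inter> g \<noteq> {})" for g
  have off: "l \<inter> g = {}" if "g \<in> others" for g
    using fixed_lines_disjoint that l by (auto simp: others_def pairwise_def disjnt_def)
  have proj: "proj g \<in> T" "proj g \<inter> g \<noteq> {}" if g: "g \<in> others" for g
  proof -
    have "x \<notin> g"
      using off[OF g] x by blast
    then have *: "proj g \<in> B \<and> x \<in> proj g \<and> proj g \<inter> g \<noteq> {}"
      using theI'[OF projection[OF xP, of g]] g unfolding proj_def others_def by blast
    then show "proj g \<inter> g \<noteq> {}"
      by blast
    show "proj g \<in> T"
      using * off[OF g] unfolding T_def by blast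
  qed
  have "T \<noteq> {}"
    using card_T t_pos by auto
  then obtain m where m: "m \<in> T" and many: "card others \<le> card (proj -` {m} \<inter> others) * t"
    using pigeonhole_card[of proj others T] proj fin card_T by blast
  define Z where "Z = proj -` {m} \<inter> others"
  have mB: "m \<in> B" "x \<in> m" "m \<noteq> l"
    using m by (auto simp: T_def)
  have moved: "f ` m \<noteq> m"
  proof
    assume "f ` m = m"
    then have "disjnt m l"
      using fixed_lines_disjoint mB l by (auto simp: pairwise_def)
    then show False
      using x mB by (auto simp: disjnt_def)
  qed
  define X where "X = (\<lambda>i. (f ^^ i) ` m) ` {..<s + 1}"
  define Y where "Y = insert l Z"
  have inj: "i = j" if "i < s + 1" "j < s + 1" "(f ^^ i) ` m = (f ^^ j) ` m" for i j
    using prime_period_funpow_inj[OF prime_s1 line_period[OF mB(1)] moved that(1,2)] that(3)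
    unfolding image_funpow by blast
  have card_X: "card X = s + 1"
    using inj unfolding X_def by (subst card_image) (auto simp: inj_on_def)
  have Y_fixed: "Y \<subseteq> fixed_lines"
    using l by (auto simp: Y_def Z_def others_def)
  have card_Y: "card Y = card Z + 1"
    using fin by (auto simp: Y_def Z_def others_def)
  have "(card X - 1) * (card Y - 1) \<le> t\<^sup>2"
  proof (rule complete_bipartite_bound[OF t_gt1])
    show "X \<subseteq> B"
      using line_image_pow mB by (auto simp: X_def)
    show "Y \<subseteq> B"
      using Y_fixed by blast
    show "pairwise disjnt Y"
      using fixed_lines_disjoint Y_fixed by (rule pairwise_subset)
    show "pairwise disjnt X"
    proof (rule pairwiseI, rule ccontr)
      \<comment> \<open>Two images of \<open>m\<close> meet \<open>l\<close> in different points, so a common point would complete a triangle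
        or lie on \<open>l\<close> itself.\<close>
      fix c d
      assume "c \<in> X" "d \<in> X" and ne: "c \<noteq> d" and "\<not> disjnt c d"
      then obtain i j q where c: "c = (f ^^ i) ` m" and d: "d = (f ^^ j) ` m"
        and ij: "i < s + 1" "j < s + 1" and q: "q \<in> c" "q \<in> d"
        by (auto simp: X_def disjnt_def)
      have B: "c \<in> B" "d \<in> B"
        using c d line_image_pow mB by auto
      have "(f ^^ i) x \<noteq> (f ^^ j) x"
        using prime_period_funpow_inj[OF prime_s1 period[OF xP] no_fixed_point[OF xP] ij] ne c d by blast
      moreover have c_l: "(f ^^ i) x \<in> c" "(f ^^ i) x \<in> l" and d_l: "(f ^^ j) x \<in> d" "(f ^^ j) x \<in> l"
        using mB c d x fixed_line_pow[OF l(2), of i] fixed_line_pow[OF l(2), of j] by auto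
      moreover have "c \<noteq> l" "d \<noteq> l"
        using line_image_pow_inj[OF mB(1) l(1)] fixed_line_pow[OF l(2)] mB c d by metis+
      ultimately have "q \<notin> l"
        using line_unique[of c l q "(f ^^ i) x"] line_unique[of d l q "(f ^^ j) x"] B l q by metis
      moreover have "q \<in> P"
        using q B line_subset by blast
      ultimately have "c = d"
        using projection[of q l] l B q c_l d_l by blast
      then show False
        using ne by blast
    qed
    show "X \<inter> Y = {}"
    proof (rule ccontr)
      assume "X \<inter> Y \<noteq> {}"
      then obtain i y where y: "y \<in> Y" "y = (f ^^ i) ` m"
        by (auto simp: X_def)
      then have yB: "y \<in> B" "f ` y = y"
        using Y_fixed by blast+
      then have "(f ^^ i) ` y = (f ^^ i) ` m"
        using fixed_line_pow[of y i] y(2) by simp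
      then have "y = m"
        by (rule line_image_pow_inj[OF yB(1) mB(1)])
      then show False
        using moved yB(2) by simp
    qed
    fix c y
    assume "c \<in> X" and y: "y \<in> Y"
    then obtain i where c: "c = (f ^^ i) ` m"
      by (auto simp: X_def)
    have "m \<inter> y \<noteq> {}"
      using y x mB proj by (auto simp: Y_def Z_def)
    then obtain z where "z \<in> m" "z \<in> y"
      by blast
    then have "(f ^^ i) z \<in> c" "(f ^^ i) z \<in> y"
      using c y Y_fixed fixed_line_pow[of y i] by auto
    then show "c \<inter> y \<noteq> {}"
      by blast
  qed
  then have "s * card Z \<le> t\<^sup>2"
    by (simp add: card_X card_Y)
  moreover have "card fixed_lines = card others + 1"
    using l finite_B unfolding others_def by (subst card.remove[of fixed_lines l]) auto
  ultimately show ?thesis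
    using many by (intro exI[of _ "card Z"] conjI) (simp_all only: Z_def mult.commute add_le_cancel_right)
qed

text \<open>With \<open>g\<close> fixed lines and \<open>g + t\<^sup>2 - 1 = (s + 1) q\<close>, the inner ceiling is at most \<open>q\<close>.
  Since \<open>(s + 1) q \<le> t n + t\<^sup>2\<close>, the outer one is at most \<open>n + t\<close>, and
  \<open>s (n + t) \<le> t\<^sup>2 + s t\<close>.\<close>

lemma parameter_inequality:
  "int s * \<lceil>real_of_int \<lceil>(real t)\<^sup>2 / (real s + 1)\<rceil> * ((real s + 1) / real t)\<rceil> \<le> int t * (int s + int t)"
proof -
  obtain n where n: "s * n \<le> t\<^sup>2" "card fixed_lines \<le> t * n + 1"
    using fixed_lines_bound by blast
  obtain q where q: "card fixed_lines + t\<^sup>2 - 1 = (s + 1) * q"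
    using dvd_card_fixed_lines by (auto elim: dvdE)
  have "card fixed_lines \<ge> 1"
    using fixed_lines_nonempty finite_B by (simp add: Suc_leI card_gt_0_iff)
  then have "t\<^sup>2 \<le> (s + 1) * q"
    using q by linarith
  then have "(real t)\<^sup>2 \<le> (real s + 1) * real q"
    by (metis of_nat_1 of_nat_add of_nat_le_iff of_nat_mult of_nat_power)
  then have "\<lceil>(real t)\<^sup>2 / (real s + 1)\<rceil> \<le> int q"
    by (simp add: ceiling_le_iff divide_le_eq mult.commute)
  then have "real_of_int \<lceil>(real t)\<^sup>2 / (real s + 1)\<rceil> * ((real s + 1) / real t) \<le> real q * ((real s + 1) / real t)"
    by (intro mult_right_mono) (linarith, simp)
  also have "\<dots> = real ((s + 1) * q) / real t"
    by (simp add: algebra_simps)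
  also have "\<dots> \<le> real (t * n + t\<^sup>2) / real t"
  proof -
    have "(s + 1) * q \<le> t * n + t\<^sup>2"
      using n(2) q by linarith
    then show ?thesis
      by (intro divide_right_mono of_nat_mono) simp_all
  qed
  also have "\<dots> = real_of_int (int (n + t))"
    using t_pos by (simp add: field_simps power2_eq_square)
  finally have "\<lceil>real_of_int \<lceil>(real t)\<^sup>2 / (real s + 1)\<rceil> * ((real s + 1) / real t)\<rceil> \<le> int (n + t)"
    by (simp only: ceiling_le_iff)
  then have "int s * \<lceil>real_of_int \<lceil>(real t)\<^sup>2 / (real s + 1)\<rceil> * ((real s + 1) / real t)\<rceil> \<le> int s * int (n + t)"
    by (intro mult_left_mono) auto
  also have "\<dots> = int (s * n + s * t)"
    by (simp add: algebra_simps)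
  also have "\<dots> \<le> int (t\<^sup>2 + s * t)"
    using n(1) by (simp only: of_nat_le_iff)
  also have "\<dots> = int t * (int s + int t)"
    by (simp add: algebra_simps power2_eq_square)
  finally show ?thesis .
qed

end


section \<open>From incidence structures to point sets\<close>

context finite_generalized_quadrangle
begin

definition points_on :: "'l \<Rightarrow> 'p set" where
  "points_on l = {p \<in> points. incident p l}"

lemma inj_on_points_on: "inj_on points_on lines"
proof (rule inj_onI, rule ccontr)
  fix l m
  assume lm: "l \<in> lines" "m \<in> lines" "points_on l = points_on m" "l \<noteq> m"
  then have "{p \<in> points. incident p l \<and> incident p m} = {p \<in> points. incident p l}"
    by (auto simp: points_on_def)
  then show False
    using at_most_one_point[OF lm(1,2,4)] line_size[OF lm(1)] s_pos by simp
qed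

lemma quadrangle_points_on: "quadrangle points (points_on ` lines) s t"
proof (rule quadrangle.intro)
  show "finite points" "points \<noteq> {}" "0 < s" "0 < t"
    using finite_points points_nonempty s_pos t_pos by auto
  show "b \<subseteq> points" if "b \<in> points_on ` lines" for b
    using that by (auto simp: points_on_def)
  show "card b = s + 1" if "b \<in> points_on ` lines" for b
    using that line_size by (auto simp: points_on_def)
  show "card {b \<in> points_on ` lines. x \<in> b} = t + 1" if x: "x \<in> points" for x
  proof -
    have "{b \<in> points_on ` lines. x \<in> b} = points_on ` {l \<in> lines. incident x l}"
      using x by (auto simp: points_on_def)
    then show ?thesis
      using point_degree[OF x] inj_on_subset[OF inj_on_points_on, of "{l \<in> lines. incident x l}"]
      by (simp add: card_image)
  qed
  show "b = c" if bc: "b \<in> points_on ` lines" "c \<in> points_on ` lines"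
    "x \<in> b" "x \<in> c" "y \<in> b" "y \<in> c" "x \<noteq> y" for b c x y
  proof (rule ccontr)
    assume "b \<noteq> c"
    with bc obtain l m where lm: "l \<in> lines" "m \<in> lines" "b = points_on l" "c = points_on m" "l \<noteq> m"
      by blast
    let ?I = "{p \<in> points. incident p l \<and> incident p m}"
    have "card ?I \<le> Suc 0"
      using at_most_one_point[OF lm(1,2,5)] by simp
    moreover have "finite ?I" "x \<in> ?I" "y \<in> ?I"
      using finite_points bc lm by (auto simp: points_on_def)
    ultimately show False
      using bc(7) card_le_Suc0_iff_eq[of ?I] by blast
  qed
  show "\<exists>!c. c \<in> points_on ` lines \<and> x \<in> c \<and> c \<inter> b \<noteq> {}"
    if x: "x \<in> points" and b: "b \<in> points_on ` lines" "x \<notin> b" for x b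
  proof -
    obtain l where l: "l \<in> lines" "b = points_on l" "\<not> incident x l"
      using x b by (auto simp: points_on_def)
    define Q where "Q z \<longleftrightarrow> z \<in> points \<times> lines \<and> incident x (snd z) \<and> incident (fst z) (snd z)
      \<and> incident (fst z) l" for z
    have "\<exists>!z. Q z"
      using unique_projection[OF x l(1,3)] by (simp only: Q_def)
    then obtain z where z: "Q z" and only: "\<And>z'. Q z' \<Longrightarrow> z' = z"
      by blast
    define y m where "y = fst z" and "m = snd z"
    have ym: "y \<in> points" "m \<in> lines" "incident x m" "incident y m" "incident y l"
      using z by (auto simp: y_def m_def Q_def)
    have uniq: "m' = m" if "y' \<in> points" "m' \<in> lines" "incident x m'" "incident y' m'" "incident y' l" for y' m'
    proof -
      have "Q (y', m')"
        using that by (simp add: Q_def)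
      then show ?thesis
        using only m_def by (metis snd_conv)
    qed
    show ?thesis
    proof (rule ex1I[of _ "points_on m"])
      show "points_on m \<in> points_on ` lines \<and> x \<in> points_on m \<and> points_on m \<inter> b \<noteq> {}"
        using ym x l by (auto simp: points_on_def)
      show "c = points_on m" if c: "c \<in> points_on ` lines \<and> x \<in> c \<and> c \<inter> b \<noteq> {}" for c
      proof -
        obtain m' where m': "m' \<in> lines" "c = points_on m'"
          using c by (elim conjE imageE)
        obtain y' where y': "y' \<in> c" "y' \<in> b"
          using c by auto
        have "m' = m"
          using m' y' c l by (intro uniq[of y']) (simp_all add: points_on_def)
        then show ?thesis
          using m' by simp
      qed
    qed
  qed
qed

lemma collinear_iff_points_on:
  "x \<in> points \<Longrightarrow> y \<in> points \<Longrightarrow>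
    collinear lines incident x y \<longleftrightarrow> (\<exists>b\<in>points_on ` lines. x \<in> b \<and> y \<in> b)"
  by (auto simp: collinear_def points_on_def)

lemma automorphism_image_line:
  assumes f: "f \<in> automorphisms points lines incident" and b: "b \<in> points_on ` lines"
  shows "f ` b \<in> points_on ` lines"
proof -
  have bij: "bij_betw f points points"
    using f by (auto simp: automorphisms_def Bij_def)
  then have "f x \<in> points" if "x \<in> points" for x
    using that by (auto simp: bij_betw_def)
  then show ?thesis
    using f b collinear_iff_points_on
    by (intro quadrangle.image_line_of_collinearity[OF quadrangle_points_on bij])
      (auto simp: automorphisms_def)
qed

end


section \<open>The automorphism group\<close>

lemma automorphism_group_pow:
  assumes f: "f \<in> carrier (automorphism_group points lines incident)" and x: "x \<in> points"
  shows "(f [^]\<^bsub>automorphism_group points lines incident\<^esub> n) x = (f ^^ n) x"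
  using x
proof (induction n arbitrary: x)
  case 0
  then show ?case
    by (simp add: automorphism_group_def BijGroup_def)
next
  case (Suc n)
  let ?G = "automorphism_group points lines incident"
  interpret group ?G
    by (rule group_automorphism_group)
  have bij: "g \<in> Bij points" if "g \<in> carrier ?G" for g
    using that by (simp add: automorphism_group_def automorphisms_def)
  have "f x \<in> points"
    using Bij_imp_funcset[OF bij[OF f]] Suc.prems by auto
  then have "(f [^]\<^bsub>?G\<^esub> n) (f x) = (f ^^ n) (f x)"
    by (rule Suc.IH)
  then show ?case
    using Suc.prems bij[OF f] bij[OF nat_pow_closed[OF f, of n]]
    by (simp add: automorphism_group_def BijGroup_def compose_eq funpow_swap1)
qed

lemma finite_automorphism_group:
  assumes "finite points"
  shows "finite (carrier (automorphism_group points lines incident))"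
proof -
  have "carrier (automorphism_group points lines incident) \<subseteq> points \<rightarrow>\<^sub>E points"
  proof
    fix f
    assume "f \<in> carrier (automorphism_group points lines incident)"
    then have "f \<in> Bij points"
      by (simp add: automorphism_group_def automorphisms_def)
    then show "f \<in> points \<rightarrow>\<^sub>E points"
      unfolding PiE_def using Bij_imp_funcset[of f points] Bij_imp_extensional[of f points] by blast
  qed
  moreover have "finite (points \<rightarrow>\<^sub>E points)"
    using assms by (intro finite_PiE)
  ultimately show ?thesis
    by (rule finite_subset)
qed

text \<open>Sylow's theorem provides a subgroup of order \<open>p\<close>, whose nonidentity elements have order \<open>p\<close>.\<close>

lemma (in group) cauchy_theorem:
  assumes fin: "finite (carrier G)" and p: "prime p" "p dvd order G"
  shows "\<exists>x\<in>carrier G. ord x = p"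
proof -
  obtain m where "order G = p * m"
    using p(2) by (rule dvdE)
  then have "order G = p ^ 1 * m"
    by simp
  from sylow_thm[OF p(1) is_group this fin] obtain H where H: "subgroup H G" "card H = p"
    by auto
  have "H \<noteq> {\<one>}"
    using H(2) p(1) by auto
  then obtain x where x: "x \<in> H" "x \<noteq> \<one>"
    using subgroup.one_closed[OF H(1)] by blast
  interpret H: group "G\<lparr>carrier := H\<rparr>"
    by (rule subgroup.subgroup_is_group[OF H(1) is_group])
  have "x [^]\<^bsub>G\<lparr>carrier := H\<rparr>\<^esub> p = \<one>"
    using H.pow_order_eq_1[of x] x(1) H(2) by (simp add: order_def)
  then have "x [^] p = \<one>"
    by (simp only: nat_pow_consistent[of x p H])
  then have "ord x dvd p"
    using pow_eq_id subgroup.mem_carrier[OF H(1) x(1)] by blast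
  moreover have "ord x \<noteq> 1"
    using ord_eq_1 subgroup.mem_carrier[OF H(1) x(1)] x(2) by simp
  ultimately have "ord x = p"
    using p(1) unfolding prime_nat_iff by blast
  then show ?thesis
    using subgroup.mem_carrier[OF H(1) x(1)] by blast
qed

lemma transitive_imp_dvd_order:
  assumes "transitive_action G E \<phi>" and "E \<noteq> {}"
  shows "card E dvd order G"
proof -
  interpret transitive_action G E \<phi>
    by (rule assms(1))
  obtain x where x: "x \<in> E"
    using assms(2) by blast
  have "orbit G \<phi> x = E"
    using x unique_orbit element_image by (fastforce simp: orbit_def)
  then show ?thesis
    using orbit_stabilizer_theorem[OF x] by (metis dvd_triv_left)
qed

theorem corollary1p2:
  fixes points :: "'p set" and lines :: "'l set"
    and incident :: "'p \<Rightarrow> 'l \<Rightarrow> bool" and s t :: nat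
  assumes "thick_finite_generalized_quadrangle points lines incident s t"
    and "s > t"
    and "prime (s + 1)"
    and "int s * \<lceil>real_of_int \<lceil>(real t)\<^sup>2 / (real s + 1)\<rceil> * ((real s + 1) / real t)\<rceil>
           > int t * (int s + int t)"
  shows "(\<nexists>f. f \<in> carrier (automorphism_group points lines incident)
             \<and> group.ord (automorphism_group points lines incident) f = s + 1)
         \<and> \<not> transitive_action (automorphism_group points lines incident) points (\<lambda>f. f)"
proof -
  interpret thick_finite_generalized_quadrangle points lines incident s t
    by (rule assms(1))
  let ?G = "automorphism_group points lines incident"
  interpret G: group ?G
    by (rule group_automorphism_group)
  have no_order: False if f: "f \<in> carrier ?G" and ord: "G.ord f = s + 1" for f
  proof -
    have aut: "f \<in> automorphisms points lines incident"
      using f by (simp add: automorphism_group_def)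
    then have Bij: "f \<in> Bij points"
      by (simp add: automorphisms_def)
    have one: "\<one>\<^bsub>?G\<^esub> = (\<lambda>x\<in>points. x)"
      by (simp add: automorphism_group_def BijGroup_def)
    interpret prime_automorphism points "points_on ` lines" s t f
    proof (rule prime_automorphism.intro[OF quadrangle_points_on], unfold_locales)
      show "bij_betw f points points"
        using Bij by (simp add: Bij_def)
      show "f ` b \<in> points_on ` lines" if "b \<in> points_on ` lines" for b
        using automorphism_image_line[OF aut that] .
      show "(f ^^ (s + 1)) x = x" if "x \<in> points" for x
        using automorphism_group_pow[OF f that, of "s + 1"] G.pow_ord_eq_1[OF f] that
        by (simp add: ord one)
      show "\<exists>x\<in>points. f x \<noteq> x"
      proof (rule ccontr)
        assume "\<not> (\<exists>x\<in>points. f x \<noteq> x)"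
        then have "f = \<one>\<^bsub>?G\<^esub>"
          unfolding one using Bij_imp_extensional[OF Bij] by (intro extensionalityI[of _ points]) auto
        then show False
          using ord G.ord_eq_1[OF f] s_pos by simp
      qed
    qed (use assms t_gt_1 in auto)
    show False
      using parameter_inequality assms(4) by linarith
  qed
  moreover have "\<not> transitive_action ?G points (\<lambda>f. f)"
  proof
    assume "transitive_action ?G points (\<lambda>f. f)"
    then have "card points dvd order ?G"
      using transitive_imp_dvd_order points_nonempty by blast
    then have "s + 1 dvd order ?G"
      using quadrangle.card_P[OF quadrangle_points_on] by (metis dvd_mult_left)
    then show False
      using G.cauchy_theorem[OF finite_automorphism_group[OF finite_points] assms(3)] no_order by blast
  qed
  ultimately show ?thesis
    by blast
qed

end
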